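(* For every integer $n \geq 0$ and every integer $i \geq 2$, \[ \widetilde{c}_i(n) = \sum_{j=2}^{i} \bar{b}_j(n) \qquad\text{and}\qquad \bar{b}_i(n) = \widetilde{c}_i(n) - \widetilde{c}_{i-1}(n), \] with the convention $\widetilde{c}_1(n) = 0$.
   Context: Tchoukaillon boards. For each $n \geq 0$ define a sequence $b(n) = (b_1(n), b_2(n), \ldots)$ of nonnegative integers recursively: $b(0)$ is the all-zero sequence; given $b(n)$, let $p(n) = \min\{j \geq 1 : b_j(n) = 0\}$ and set $b_i(n+1) = b_i(n)$ if $i > p(n)$, $b_i(n+1) = i$ if $i = p(n)$, and $b_i(n+1) = b_i(n) - 1$ if $i < p(n)$. Reindexed boards: $\bar{b}_i(n) = b_{i-1}(n)$ for $i \geq 2$. Remainder boards: for $i \geq 2$ let $c_i(n) \in \{0, 1, \ldots, i-1\}$ be the remainder of $n$ modulo $i$. Increasing remainder board: $\widetilde{c}_2(n) = c_2(n)$, and for $i \geq 3$, $\widetilde{c}_i(n)$ is the least integer $\geq \widetilde{c}_{i-1}(n)$ that is congruent to $c_i(n)$ modulo $i$. *)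

theory Defs
  imports "HOL-Number_Theory.Cong"
begin

text \<open>
  Boards are functions of the pit number; pits are numbered from 1, so the value at 0 is
  irrelevant.
\<close>

definition first_empty :: "(nat \<Rightarrow> nat) \<Rightarrow> nat" where
  "first_empty b = (LEAST j. 1 \<le> j \<and> b j = 0)"

text \<open>
  The subtraction below does not truncate at pits \<open>i \<ge> 1\<close>: a pit before the first empty one is
  nonempty.
\<close>

primrec tchoukaillon :: "nat \<Rightarrow> nat \<Rightarrow> nat" where
  "tchoukaillon 0 = (\<lambda>i. 0)"
| "tchoukaillon (Suc n) = (\<lambda>i.
     if i > first_empty (tchoukaillon n) then tchoukaillon n i
     else if i = first_empty (tchoukaillon n) then i
     else tchoukaillon n i - 1)"

text \<open>The reindexed board \<open>bar b\<close>, meaningful for \<open>i \<ge> 2\<close>.\<close>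

definition tchoukaillon_bar :: "nat \<Rightarrow> nat \<Rightarrow> nat" where
  "tchoukaillon_bar n i = tchoukaillon n (i - 1)"

definition remainder_board :: "nat \<Rightarrow> nat \<Rightarrow> nat" where
  "remainder_board n i = n mod i"

text \<open>
  The increasing remainder board, with the convention that its entry at index 1 is 0 (and a dummy
  0 at index 0). All entries are nonnegative, so the least integer above the previous entry in the
  given residue class is the least such natural number.
\<close>

fun incr_remainder_board :: "nat \<Rightarrow> nat \<Rightarrow> nat" where
  "incr_remainder_board n 0 = 0"
| "incr_remainder_board n (Suc 0) = 0"
| "incr_remainder_board n (Suc (Suc 0)) = remainder_board n 2"
| "incr_remainder_board n (Suc (Suc (Suc k))) =
     (LEAST m. incr_remainder_board n (Suc (Suc k)) \<le> m \<and>
        [m = remainder_board n (Suc (Suc (Suc k)))] (mod Suc (Suc (Suc k))))"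

end

theory Submission
  imports Defs
begin

text \<open>
  Playing one move changes the content of the first \<open>m\<close> pits by \<open>+1\<close> if the first empty pit is
  among them and by \<open>-m\<close> otherwise, hence by \<open>1\<close> modulo \<open>m + 1\<close> in either case. So the first \<open>m\<close>
  pits contain \<open>n\<close> stones modulo \<open>m + 1\<close>. Since pit \<open>i - 1\<close> never holds more than \<open>i - 1\<close> stones, the
  partial sums of the board climb by less than \<open>i\<close> from index \<open>i - 1\<close> to \<open>i\<close>, which is the
  minimality defining the increasing remainder board.
\<close>

text \<open>A move changes no pit beyond the first empty one. This guarantees that the
  \<open>LEAST\<close> in \<open>first_empty\<close> is attained.\<close>

lemma tchoukaillon_eventually_empty: "\<exists>N. \<forall>i>N. tchoukaillon n i = 0"
proof (induction n)
  case (Suc n)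
  then obtain N where "\<forall>i>N. tchoukaillon n i = 0" by blast
  then have "\<forall>i>max N (first_empty (tchoukaillon n)). tchoukaillon (Suc n) i = 0" by simp
  then show ?case by blast
qed simp

lemma first_empty_tchoukaillon:
  "1 \<le> first_empty (tchoukaillon n)"
  "tchoukaillon n (first_empty (tchoukaillon n)) = 0"
proof -
  obtain N where "\<forall>i>N. tchoukaillon n i = 0"
    using tchoukaillon_eventually_empty by blast
  then have "1 \<le> Suc N \<and> tchoukaillon n (Suc N) = 0" by simp
  from LeastI[of "\<lambda>j. 1 \<le> j \<and> tchoukaillon n j = 0", OF this]
  show "1 \<le> first_empty (tchoukaillon n)"
    "tchoukaillon n (first_empty (tchoukaillon n)) = 0"
    unfolding first_empty_def by auto
qed

lemma pos_if_less_first_empty: "1 \<le> k \<Longrightarrow> k < first_empty b \<Longrightarrow> 0 < b k"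
  unfolding first_empty_def using not_less_Least[of k "\<lambda>j. 1 \<le> j \<and> b j = 0"] by simp

lemma tchoukaillon_le: "tchoukaillon n i \<le> i"
proof (induction n)
  case (Suc n)
  then show ?case by (simp add: le_diff_conv)
qed simp

text \<open>The loss of \<open>m\<close> stones appears as \<open>+ m\<close> on the left, which
  avoids truncated subtraction.\<close>

lemma sum_tchoukaillon_Suc:
  defines "p \<equiv> \<lambda>n. first_empty (tchoukaillon n)"
  shows "if m < p n
    then (\<Sum>k=1..m. tchoukaillon (Suc n) k) + m = (\<Sum>k=1..m. tchoukaillon n k)
    else (\<Sum>k=1..m. tchoukaillon (Suc n) k) = Suc (\<Sum>k=1..m. tchoukaillon n k)"
proof (induction m)
  case 0
  then show ?case using first_empty_tchoukaillon(1)[of n] by (simp add: p_def)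
next
  case (Suc m)
  consider "Suc m < p n" | "Suc m = p n" | "p n < Suc m" by linarith
  then show ?case
  proof cases
    case 1
    then have "0 < tchoukaillon n (Suc m)"
      using pos_if_less_first_empty[of "Suc m"] by (simp add: p_def)
    with 1 Suc show ?thesis by (simp add: p_def)
  next
    case 2
    \<comment> \<open>The \<open>Suc m\<close> stones placed in the empty pit outweigh the
      \<open>m\<close> taken from the earlier pits by exactly one.\<close>
    then have "tchoukaillon n (Suc m) = 0"
      using first_empty_tchoukaillon(2)[of n] by (simp add: p_def)
    moreover have "tchoukaillon (Suc n) (Suc m) = Suc m"
      using 2 by (simp add: p_def)
    moreover have "(\<Sum>k=1..m. tchoukaillon (Suc n) k) + m = (\<Sum>k=1..m. tchoukaillon n k)"
      using 2 Suc by presburger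
    ultimately have
      "(\<Sum>k=1..Suc m. tchoukaillon (Suc n) k) = Suc (\<Sum>k=1..Suc m. tchoukaillon n k)"
      by (simp del: tchoukaillon.simps)
    with 2 show ?thesis by presburger
  next
    case 3
    then show ?thesis using Suc by (simp add: p_def)
  qed
qed

lemma sum_tchoukaillon_cong: "[(\<Sum>k=1..m. tchoukaillon n k) = n] (mod Suc m)"
proof (induction n)
  case (Suc n)
  let ?S = "\<lambda>n. \<Sum>k=1..m. tchoukaillon n k"
  have "?S (Suc n) + m = ?S n \<or> ?S (Suc n) = Suc (?S n)"
    using sum_tchoukaillon_Suc[of m n] by presburger
  \<comment> \<open>One more stone on both sides turns the loss of \<open>m\<close> into a gain of 1
    up to the modulus \<open>Suc m\<close>.\<close>
  then have "?S (Suc n) + Suc m = Suc (?S n) \<or> ?S (Suc n) = Suc (?S n)"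
    by linarith
  then have "?S (Suc n) mod Suc m = Suc (?S n) mod Suc m"
    by (metis mod_add_self2)
  also have "\<dots> = Suc n mod Suc m"
    using Suc unfolding cong_def by (metis mod_Suc_eq)
  finally show ?case unfolding cong_def .
qed simp

text \<open>A smaller candidate \<open>y \<ge> a\<close> would differ from \<open>a + d\<close> by a
  positive multiple of \<open>q\<close>, yet by at most \<open>d < q\<close>.\<close>

lemma Least_cong_nat:
  fixes a d q r :: nat
  assumes "d < q" and "[a + d = r] (mod q)"
  shows "(LEAST m. a \<le> m \<and> [m = r] (mod q)) = a + d"
proof (rule Least_equality)
  show "a \<le> a + d \<and> [a + d = r] (mod q)" using assms by simp
  fix y
  assume y: "a \<le> y \<and> [y = r] (mod q)"
  show "a + d \<le> y"
  proof (rule ccontr)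
    assume less: "\<not> a + d \<le> y"
    have "[a + d = y] (mod q)" using y assms cong_sym cong_trans by blast
    then have "q dvd (a + d) - y" using less by (simp add: cong_altdef_nat)
    then have "q \<le> (a + d) - y" using less by (intro dvd_imp_le) auto
    then show False using y assms(1) by linarith
  qed
qed

lemma incr_remainder_board_Suc:
  "incr_remainder_board n (Suc m) = (\<Sum>k=1..m. tchoukaillon n k)"
proof (induction m)
  case (Suc m)
  show ?case
  proof (cases m)
    case 0
    \<comment> \<open>Index 2 is a plain remainder without \<open>LEAST\<close>; pit 1 holds at most
      one stone, so its class modulo 2 determines it.\<close>
    have "tchoukaillon n 1 = n mod 2"
      using sum_tchoukaillon_cong[of n 1] tchoukaillon_le[of n 1]
      by (simp add: cong_def flip: numeral_2_eq_2)
    with 0 show ?thesis by (simp add: remainder_board_def)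
  next
    case (Suc k)
    have "[(\<Sum>k=1..m. tchoukaillon n k) + tchoukaillon n (Suc m) = n mod Suc (Suc m)]
        (mod Suc (Suc m))"
      using sum_tchoukaillon_cong[of n "Suc m"] by (simp add: cong_def)
    moreover have "tchoukaillon n (Suc m) < Suc (Suc m)"
      using tchoukaillon_le[of n "Suc m"] by linarith
    ultimately have "(LEAST l. (\<Sum>k=1..m. tchoukaillon n k) \<le> l \<and>
        [l = n mod Suc (Suc m)] (mod Suc (Suc m)))
      = (\<Sum>k=1..m. tchoukaillon n k) + tchoukaillon n (Suc m)"
      by (intro Least_cong_nat)
    also have "\<dots> = (\<Sum>k=1..Suc m. tchoukaillon n k)"
      by simp
    finally show ?thesis
      \<comment> \<open>The induction hypothesis turns the lower bound inside \<open>LEAST\<close>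
        into the previous board entry, as in the recursive equation.\<close>
      unfolding Suc.IH[symmetric]
      unfolding Suc incr_remainder_board.simps(4) remainder_board_def .
  qed
qed simp

theorem theorem4p2:
  fixes n i :: nat
  assumes "i \<ge> 2"
  shows "incr_remainder_board n i = (\<Sum>j=2..i. tchoukaillon_bar n j) \<and>
    int (tchoukaillon_bar n i) =
      int (incr_remainder_board n i) - int (incr_remainder_board n (i - 1))"
proof -
  obtain m where i: "i = Suc (Suc m)"
    using le_Suc_ex[OF assms] by auto
  have "(\<Sum>j=2..i. tchoukaillon_bar n j) = (\<Sum>k=1..Suc m. tchoukaillon n k)"
    using sum.shift_bounds_cl_Suc_ivl[of "tchoukaillon_bar n" 1 "Suc m"]
    by (simp add: i tchoukaillon_bar_def numeral_2_eq_2)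
  \<comment> \<open>The second identity follows because consecutive partial sums differ by the last
    pit.\<close>
  then show ?thesis
    unfolding i diff_Suc_1 incr_remainder_board_Suc by (simp add: tchoukaillon_bar_def)
qed

end
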